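(* Let $n\ge 3$ be odd with prime factorization $n=p_1^{e_1}\cdots p_N^{e_N}$, where $p_1,\dots,p_N$ are distinct odd primes and $e_j\ge 1$. For $A\subseteq\{1,\dots,N\}$ put $p_A=\prod_{j\in A}p_j$ (with $p_\emptyset=1$). Then, as rational functions in $x$, $$C(n,x)=\frac{\displaystyle\prod_{A\subseteq\{1,\dots,N\},\ |A|\ \text{even}}q\left(\frac{n/p_A-1}{2},x\right)}{\displaystyle\prod_{A\subseteq\{1,\dots,N\},\ |A|\ \text{odd}}q\left(\frac{n/p_A-1}{2},x\right)} .$$
   Context: $C(n,x)$ is the minimal polynomial over $\mathbb Q$ of $2\cos(\pi/n)$. $S(k,x)=U_k(x/2)$, where $U_k$ is the Chebyshev polynomial of the second kind. For $k\ge 0$ the $q$-polynomials are defined by $q(k,x)=\dfrac{S(2k,x)}{S(2k,\sqrt{2+x})}$ (since $S(2k,y)$ is an even polynomial in $y$, the denominator is a polynomial in $x$); this quotient is a monic integer polynomial of degree $k$ in $x$. *)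

theory Defs
  imports Complex_Main "HOL-Computational_Algebra.Computational_Algebra"
begin

definition rat_eval :: "rat poly \<Rightarrow> real \<Rightarrow> real" where
  "rat_eval p a = poly (map_poly of_rat p) a"

definition is_rat_min_poly :: "real \<Rightarrow> rat poly \<Rightarrow> bool" where
  "is_rat_min_poly a p \<longleftrightarrow> lead_coeff p = 1 \<and> rat_eval p a = 0 \<and>
     (\<forall>r. r \<noteq> 0 \<and> rat_eval r a = 0 \<longrightarrow> degree p \<le> degree r)"

text \<open>Only meaningful for algebraic \<open>a\<close>; see \<open>rat_min_poly_spec\<close> below.\<close>

definition rat_min_poly :: "real \<Rightarrow> rat poly" where
  "rat_min_poly a = (THE p. is_rat_min_poly a p)"

definition C_poly :: "nat \<Rightarrow> rat poly" where
  "C_poly n = rat_min_poly (2 * cos (pi / real n))"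

fun cheb_U :: "nat \<Rightarrow> rat poly" where
  "cheb_U 0 = 1"
| "cheb_U (Suc 0) = [:0, 2:]"
| "cheb_U (Suc (Suc k)) = [:0, 2:] * cheb_U (Suc k) - cheb_U k"

definition S_poly :: "nat \<Rightarrow> rat poly" where
  "S_poly k = pcompose (cheb_U k) [:0, 1/2:]"

text \<open>For an even polynomial \<open>p(y)\<close> this is the \<open>r\<close> with \<open>p(y) = r(y\<^sup>2)\<close>.\<close>

definition even_half :: "rat poly \<Rightarrow> rat poly" where
  "even_half p = (\<Sum>i\<le>degree p. monom (coeff p (2 * i)) i)"

text \<open>The polynomial \<open>S(2k, sqrt (2 + x))\<close> in \<open>x\<close>; see \<open>rat_eval_q_denom\<close> below.\<close>

definition q_denom :: "nat \<Rightarrow> rat poly" where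
  "q_denom k = pcompose (even_half (S_poly (2 * k))) [:2, 1:]"

definition q_fun :: "nat \<Rightarrow> rat poly fract" where
  "q_fun k = to_fract (S_poly (2 * k)) / to_fract (q_denom k)"


lemma rat_eval_0 [simp]: "rat_eval 0 a = 0"
  and rat_eval_1 [simp]: "rat_eval 1 a = 1"
  by (simp_all add: rat_eval_def)

lemma rat_eval_pCons [simp]: "rat_eval (pCons c p) a = of_rat c + a * rat_eval p a"
  by (simp add: rat_eval_def map_poly_pCons)

lemma rat_eval_add [simp]: "rat_eval (p + r) a = rat_eval p a + rat_eval r a"
proof (induction p arbitrary: r)
  case (pCons c p)
  then show ?case by (cases r) (simp add: of_rat_add algebra_simps)
qed simp

lemma rat_eval_smult [simp]: "rat_eval (smult c p) a = of_rat c * rat_eval p a"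
  by (induction p) (simp_all add: of_rat_mult algebra_simps)

lemma rat_eval_diff [simp]: "rat_eval (p - r) a = rat_eval p a - rat_eval r a"
  using rat_eval_add[of "p - r" r a] by simp

lemma rat_eval_mult [simp]: "rat_eval (p * r) a = rat_eval p a * rat_eval r a"
  by (induction p) (simp_all add: algebra_simps)

lemma rat_eval_pcompose: "rat_eval (pcompose p r) a = rat_eval p (rat_eval r a)"
  by (induction p) (simp_all add: pcompose_pCons algebra_simps)

lemma rat_eval_altdef:
  assumes "degree p \<le> n"
  shows "rat_eval p a = (\<Sum>i\<le>n. of_rat (coeff p i) * a ^ i)"
proof -
  have "rat_eval p a = (\<Sum>i\<le>degree p. of_rat (coeff p i) * a ^ i)"
    by (simp add: rat_eval_def poly_altdef coeff_map_poly degree_map_poly)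
  also have "\<dots> = (\<Sum>i\<le>n. of_rat (coeff p i) * a ^ i)"
    using assms by (intro sum.mono_neutral_left) (auto intro: coeff_eq_0)
  finally show ?thesis .
qed


lemma is_rat_min_poly_unique:
  assumes "is_rat_min_poly a p" "is_rat_min_poly a r"
  shows "p = r"
proof (rule ccontr)
  assume "p \<noteq> r"
  have deg: "degree p = degree r"
    using assms unfolding is_rat_min_poly_def
    by (metis le_antisym leading_coeff_0_iff zero_neq_one)
  have nz: "p - r \<noteq> 0" and z: "rat_eval (p - r) a = 0"
    using assms \<open>p \<noteq> r\<close> by (auto simp: is_rat_min_poly_def)
  have le: "degree p \<le> degree (p - r)"
    using assms(1) nz z unfolding is_rat_min_poly_def by blast
  have "degree (p - r) \<le> degree p" using deg by (simp add: degree_diff_le)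
  with le have "degree (p - r) = degree p" by simp
  then have "lead_coeff (p - r) = 0"
    using assms deg by (simp add: is_rat_min_poly_def)
  with nz show False by (metis leading_coeff_0_iff)
qed

lemma is_rat_min_poly_exists:
  assumes "r \<noteq> 0" "rat_eval r a = 0"
  shows "\<exists>p. is_rat_min_poly a p"
proof -
  define P where "P = (\<lambda>p. p \<noteq> 0 \<and> rat_eval p a = 0)"
  obtain p where p: "P p" "\<And>s. P s \<Longrightarrow> degree p \<le> degree s"
    using assms arg_min_natI[of P r degree] arg_min_nat_le[of P _ degree]
    by (metis P_def)
  have "is_rat_min_poly a (smult (inverse (lead_coeff p)) p)"
    using p by (auto simp: is_rat_min_poly_def P_def)
  then show ?thesis ..
qed

lemma rat_min_poly_spec:
  assumes "r \<noteq> 0" "rat_eval r a = 0"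
  shows "is_rat_min_poly a (rat_min_poly a)"
  unfolding rat_min_poly_def
  using is_rat_min_poly_exists[OF assms] is_rat_min_poly_unique by (metis theI)


lemma S_poly_0 [simp]: "S_poly 0 = 1"
  and S_poly_1 [simp]: "S_poly (Suc 0) = [:0, 1:]"
  by (simp_all add: S_poly_def pcompose_pCons pcompose_1)

lemma S_poly_rec: "S_poly (Suc (Suc k)) = [:0, 1:] * S_poly (Suc k) - S_poly k"
  by (simp add: S_poly_def pcompose_diff pcompose_mult pcompose_pCons pcompose_smult)

lemma degree_S_poly: "degree (S_poly k) = k \<and> lead_coeff (S_poly k) = 1"
proof (induction k rule: cheb_U.induct)
  case (3 k)
  have nz: "S_poly (Suc k) \<noteq> 0" using 3 by auto
  have eq: "S_poly (Suc (Suc k)) = pCons 0 (S_poly (Suc k)) + (- S_poly k)"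
    by (simp add: S_poly_rec)
  have lt: "degree (- S_poly k) < degree (pCons 0 (S_poly (Suc k)))" using 3 nz by simp
  have "degree (S_poly (Suc (Suc k))) = degree (pCons 0 (S_poly (Suc k)))"
    unfolding eq by (rule degree_add_eq_left[OF lt])
  moreover have "lead_coeff (S_poly (Suc (Suc k))) = lead_coeff (pCons 0 (S_poly (Suc k)))"
    unfolding eq by (metis add.commute lead_coeff_add_le[OF lt])
  moreover have "lead_coeff (pCons 0 (S_poly (Suc k))) = lead_coeff (S_poly (Suc k))"
    using nz by simp
  ultimately show ?case using 3 nz by (metis degree_pCons_eq)
qed simp_all

lemma S_poly_nonzero [simp]: "S_poly k \<noteq> 0"
  using degree_S_poly[of k] by auto

lemma coeff_S_poly_parity: "odd (i + k) \<Longrightarrow> coeff (S_poly k) i = 0"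
proof (induction k arbitrary: i rule: cheb_U.induct)
  case (3 k)
  then show ?case by (cases i) (simp_all add: S_poly_rec)
next
  case 1
  then show ?case by (cases i) auto
next
  case 2
  then show ?case by (cases i) (auto simp: coeff_pCons elim: oddE split: nat.splits)
qed

lemma rat_eval_S_poly_cos: "rat_eval (S_poly k) (2 * cos t) * sin t = sin (real (Suc k) * t)"
proof (induction k rule: cheb_U.induct)
  case 2
  then show ?case using sin_double[of t] by (simp add: algebra_simps)
next
  case (3 k)
  have "sin (real (Suc (Suc (Suc k))) * t) + sin (real (Suc k) * t)
      = 2 * cos t * sin (real (Suc (Suc k)) * t)"
    using sin_add[of "real (Suc (Suc k)) * t" t] sin_diff[of "real (Suc (Suc k)) * t" t]
    by (simp add: algebra_simps)
  with 3 show ?case by (simp add: S_poly_rec algebra_simps)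
qed simp

lemma C_poly_spec:
  assumes "n \<ge> 2"
  shows "is_rat_min_poly (2 * cos (pi / real n)) (C_poly n)"
proof -
  have "sin (pi / real n) > 0"
    using assms by (intro sin_gt_zero) (auto simp: field_simps)
  moreover have "rat_eval (S_poly (n - 1)) (2 * cos (pi / real n)) * sin (pi / real n) = 0"
    unfolding rat_eval_S_poly_cos using assms by simp
  ultimately have "rat_eval (S_poly (n - 1)) (2 * cos (pi / real n)) = 0" by simp
  then show ?thesis unfolding C_poly_def by (intro rat_min_poly_spec) auto
qed

lemma rat_eval_even_half:
  assumes "\<And>i. odd i \<Longrightarrow> coeff p i = 0"
  shows "rat_eval (even_half p) (y\<^sup>2) = rat_eval p y"
proof -
  let ?n = "degree p"
  have c: "coeff (even_half p) i = coeff p (2 * i)" for i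
    by (auto simp: even_half_def coeff_sum coeff_monom coeff_eq_0)
  have "degree (even_half p) \<le> ?n"
    by (rule degree_le) (auto simp: c coeff_eq_0)
  then have "rat_eval (even_half p) (y\<^sup>2) = (\<Sum>i\<le>?n. of_rat (coeff p (2 * i)) * y ^ (2 * i))"
    by (simp add: rat_eval_altdef c power_mult)
  also have "\<dots> = (\<Sum>j\<in>(\<lambda>i. 2 * i) ` {..?n}. of_rat (coeff p j) * y ^ j)"
    by (subst sum.reindex) (auto simp: inj_on_def)
  also have "\<dots> = (\<Sum>j\<le>2 * ?n. of_rat (coeff p j) * y ^ j)"
  proof (intro sum.mono_neutral_left ballI)
    fix j assume "j \<in> {..2 * ?n} - (\<lambda>i. 2 * i) ` {..?n}"
    then have "odd j" by (auto elim!: evenE)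
    then show "of_rat (coeff p j) * y ^ j = 0" by (simp add: assms)
  qed auto
  also have "\<dots> = rat_eval p y" by (rule rat_eval_altdef[symmetric]) simp
  finally show ?thesis .
qed

lemma rat_eval_q_denom:
  assumes "x \<ge> -2"
  shows "rat_eval (q_denom k) x = rat_eval (S_poly (2 * k)) (sqrt (2 + x))"
  using assms rat_eval_even_half[of "S_poly (2 * k)" "sqrt (2 + x)"]
  by (simp add: q_denom_def rat_eval_pcompose coeff_S_poly_parity)

lemma q_denom_nonzero [simp]: "q_denom k \<noteq> 0"
proof
  assume "q_denom k = 0"
  then have "rat_eval (q_denom k) (-1) = 0 \<and> rat_eval (q_denom k) 2 = 0" by simp
  moreover have "rat_eval (S_poly j) 2 = real (Suc j)" for j
    by (induction j rule: cheb_U.induct) (auto simp: S_poly_rec)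
  ultimately show False using rat_eval_q_denom[of 2 k] by simp
qed

end

theory Submission
  imports Defs
begin

text \<open>
  With \<open>m = 2k + 1\<close> and \<open>x = 2 cos t\<close> one has \<open>q(k, x) = cos (m t / 2) / cos (t / 2)\<close>, so \<open>q(k, x)\<close> is the
  product of \<open>x - 2 cos (j \<pi> / m)\<close> over the odd \<open>j < m\<close>. For \<open>m = n / p\<^sub>A\<close> these are the roots
  \<open>2 cos (j \<pi> / n)\<close> with \<open>j\<close> odd and \<open>p\<^sub>A\<close> dividing \<open>j\<close>. A nonempty finite set has as many even as odd
  subsets, so the alternating product over \<open>A\<close> leaves exactly the \<open>j\<close> coprime to \<open>n\<close>.

  That these remaining roots are all conjugate follows from an argument of Landau. Let \<open>f\<close> be an integer
  polynomial and \<open>\<omega>\<close> a root of unity of order dividing \<open>m\<close>. If \<open>f(\<omega>\<^sup>k) = 0\<close> and \<open>p\<close> is prime, then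
  \<open>f(\<omega>\<^sup>k\<^sup>p)\<close> is congruent to \<open>f(\<omega>\<^sup>k)\<^sup>p = 0\<close> modulo \<open>p\<close> in \<open>\<int>[\<omega>]\<close>. The finitely many nonzero values \<open>f(\<omega>\<^sup>i)\<close> are divisible
  by only finitely many primes, hence \<open>f(\<omega>\<^sup>k\<^sup>p) = 0\<close> for all large \<open>p\<close>, and every class coprime to \<open>m\<close>
  contains a product of large primes.
\<close>

section \<open>The Frobenius congruence modulo a prime\<close>

lemma map_poly_add_hom:
  assumes "h 0 = 0" "\<And>a b. h (a + b) = h a + h b"
  shows "map_poly h (p + q) = map_poly h p + map_poly h q"
  using assms by (intro poly_eqI) (simp add: coeff_map_poly)

lemma map_poly_mult_hom:
  fixes h :: "'a::comm_ring_1 \<Rightarrow> 'b::comm_ring_1"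
  assumes "h 0 = 0" "\<And>a b. h (a + b) = h a + h b" "\<And>a b. h (a * b) = h a * h b"
  shows "map_poly h (p * q) = map_poly h p * map_poly h q"
proof (induction p)
  case (pCons a p)
  then show ?case
    using assms by (simp add: map_poly_pCons map_poly_add_hom map_poly_smult)
qed simp

text \<open>The inner binomial coefficients are multiples of \<open>p\<close>. A general commutative
  ring is taken because both integers and integer polynomials are needed.\<close>

lemma prime_dvd_power_add_diff:
  fixes x y :: "'a::comm_ring_1"
  assumes "prime p"
  shows "of_nat p dvd (x + y) ^ p - (x ^ p + y ^ p)"
proof -
  let ?t = "\<lambda>k. of_nat (p choose k) * x ^ k * y ^ (p - k)"
  have p: "p > 0" using assms prime_gt_0_nat by blast
  have "(x + y) ^ p = (\<Sum>k\<le>p. ?t k)" by (rule binomial_ring)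
  also have "{..p} = insert 0 (insert p {0<..<p})" by auto
  also have "sum ?t \<dots> = y ^ p + (x ^ p + (\<Sum>k\<in>{0<..<p}. ?t k))"
    using p by simp
  finally have "(x + y) ^ p - (x ^ p + y ^ p) = (\<Sum>k\<in>{0<..<p}. ?t k)" by simp
  moreover have "of_nat p dvd ?t k" if "k \<in> {0<..<p}" for k
  proof -
    have "p dvd (p choose k)" using that assms by (intro dvd_choose_prime) auto
    then obtain c where "p choose k = p * c" by (rule dvdE)
    then show ?thesis by (simp add: mult.assoc)
  qed
  ultimately show ?thesis by (auto intro!: dvd_sum)
qed

text \<open>Fermat's little theorem. The auxiliary fact \<open>step\<close> is an equivalence so
  that it serves the induction from 0 in both directions.\<close>

lemma prime_dvd_int_power_diff:
  fixes a :: int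
  assumes "prime p"
  shows "int p dvd a ^ p - a"
proof -
  have p: "p > 0" using assms prime_gt_0_nat by blast
  have step: "int p dvd (b + 1) ^ p - (b + 1) \<longleftrightarrow> int p dvd b ^ p - b" for b :: int
  proof -
    have "int p dvd (b + 1) ^ p - (b ^ p + 1)"
      using prime_dvd_power_add_diff[OF assms, of b 1] by simp
    moreover have "(b + 1) ^ p - (b + 1) = ((b + 1) ^ p - (b ^ p + 1)) + (b ^ p - b)" by simp
    ultimately show ?thesis by (simp only: dvd_add_right_iff)
  qed
  show ?thesis
  proof (induction a rule: int_induct[where k = 0])
    case base
    then show ?case using p by (simp add: power_0_left)
  next
    case (step1 i)
    then show ?case using step[of i] by blast
  next
    case (step2 i)
    then show ?case using step[of "i - 1"] by simp
  qed
qed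

text \<open>Induction on the coefficients: for \<open>a + X * f\<close> the difference splits into
  the induction hypothesis times a power of \<open>X\<close>, Fermat's theorem for \<open>a\<close>,
  and the binomial congruence.\<close>

lemma prime_dvd_pcompose_monom_diff:
  fixes f :: "int poly"
  assumes "prime p"
  shows "of_nat p dvd pcompose f (monom 1 p) - f ^ p"
proof (induction f)
  case 0
  then show ?case using assms prime_gt_0_nat[of p] by (simp add: power_0_left)
next
  case (pCons a f)
  let ?X = "[:0, 1:] :: int poly"
  have X: "monom 1 p = ?X ^ p" by (simp add: monom_altdef)
  have a: "of_nat p dvd [:a:] ^ p - [:a:]"
    using prime_dvd_int_power_diff[OF assms, of a]
    by (auto simp: poly_const_pow of_nat_poly const_poly_dvd_iff coeff_pCons split: nat.splits)
  have s: "of_nat p dvd ([:a:] + ?X * f) ^ p - ([:a:] ^ p + (?X * f) ^ p)"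
    by (rule prime_dvd_power_add_diff[OF assms])
  have eq: "pcompose (pCons a f) (monom 1 p) - pCons a f ^ p =
     ?X ^ p * (pcompose f (monom 1 p) - f ^ p)
     - (([:a:] ^ p - [:a:]) + (([:a:] + ?X * f) ^ p - ([:a:] ^ p + (?X * f) ^ p)))"
  proof -
    have c: "pCons a f = [:a:] + ?X * f" by simp
    show ?thesis
      unfolding pcompose_pCons X unfolding c by (simp only: power_mult_distrib) algebra
  qed
  show ?case unfolding eq by (intro dvd_diff[OF dvd_mult[OF pCons.IH] dvd_add[OF a s]])
qed

text \<open>Elements of the ring generated by a root of unity are handled as values of integer
  polynomials; this is the congruence in that language.\<close>

lemma frobenius_eval:
  fixes f :: "int poly" and z :: complex
  assumes "prime p"
  obtains g :: "int poly" where
    "\<And>z::complex. poly (map_poly of_int f) (z ^ p) =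
      poly (map_poly of_int f) z ^ p + of_nat p * poly (map_poly of_int g) z"
proof -
  obtain g where g: "pcompose f (monom 1 p) - f ^ p = of_nat p * g"
    using prime_dvd_pcompose_monom_diff[OF assms] by (auto simp: dvd_def)
  let ?e = "\<lambda>f::int poly. \<lambda>z::complex. poly (map_poly of_int f) z"
  have add: "?e (u + v) z = ?e u z + ?e v z" for u v z
    by (simp add: map_poly_add_hom)
  have mult: "?e (u * v) z = ?e u z * ?e v z" for u v z
    by (simp add: map_poly_mult_hom)
  have pow: "?e (u ^ k) z = ?e u z ^ k" for u k z
    by (induction k) (simp_all add: mult)
  have comp: "?e (pcompose u v) z = ?e u (?e v z)" for u v z
    by (induction u) (simp_all add: pcompose_pCons map_poly_pCons add mult)
  have "pcompose f (monom 1 p) = f ^ p + of_nat p * g" using g by (simp add: algebra_simps)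
  then have "?e f (z ^ p) = ?e f z ^ p + of_nat p * ?e g z" for z
    using comp[of f "monom 1 p" z]
    by (simp add: add mult pow map_poly_monom poly_monom of_nat_poly map_poly_smult)
  then show thesis by (rule that)
qed

section \<open>Divisibility by large integers in the ring generated by a root of unity\<close>

text \<open>The independent set \<open>{y}\<close> extends to a basis of the complex numbers over
  the rationals.\<close>

lemma rational_linear_functional_exists:
  fixes y :: complex
  assumes "y \<noteq> 0"
  obtains \<phi> :: "complex \<Rightarrow> rat" where "\<And>u v. \<phi> (u + v) = \<phi> u + \<phi> v"
    "\<And>q u. \<phi> (of_rat q * u) = q * \<phi> u" "\<phi> y = 1"
proof -
  interpret vector_space_pair "\<lambda>(q::rat) (z::complex). of_rat q * z" "(*) :: rat \<Rightarrow> rat \<Rightarrow> rat"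
    by unfold_locales (auto simp: algebra_simps of_rat_add of_rat_mult)
  have "vs1.independent {y}" using assms by simp
  from linear_independent_extend[OF this, of "\<lambda>_. 1"] obtain \<phi> where
    \<phi>: "Vector_Spaces.linear (\<lambda>(q::rat) (z::complex). of_rat q * z) (*) \<phi>" "\<phi> y = 1" by auto
  then show thesis
    using that[of \<phi>] linear_add[OF \<phi>(1)] linear_scale[OF \<phi>(1)] by simp
qed

text \<open>A rational linear functional taking \<open>y\<close> to \<open>1\<close> has bounded denominators on the finitely generated
  ring generated by \<open>\<omega>\<close>, so \<open>y\<close> is not divisible there by large integers.\<close>

lemma int_poly_eval_divisor_bound:
  fixes \<omega> y :: complex
  assumes "m > 0" "\<omega> ^ m = 1" "y \<noteq> 0"
  shows "\<exists>N. \<forall>p. \<forall>g::int poly. y = of_nat p * poly (map_poly of_int g) \<omega> \<longrightarrow> p \<le> N"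
proof -
  obtain \<phi> :: "complex \<Rightarrow> rat" where add: "\<And>u v. \<phi> (u + v) = \<phi> u + \<phi> v"
    and scale: "\<And>q u. \<phi> (of_rat q * u) = q * \<phi> u" and y: "\<phi> y = 1"
    using rational_linear_functional_exists[OF assms(3)] by metis
  have z: "\<phi> 0 = 0" using add[of 0 0] by simp
  define d where "d = (\<lambda>i. snd (quotient_of (\<phi> (\<omega> ^ i))))"
  have dpos: "d i > 0" for i by (simp add: d_def quotient_of_denom_pos')
  have dint: "of_int (d i) * \<phi> (\<omega> ^ i) \<in> \<int>" for i
  proof -
    have "\<phi> (\<omega> ^ i) = of_int (fst (quotient_of (\<phi> (\<omega> ^ i)))) / of_int (d i)"
      by (simp add: d_def quotient_of_div prod.expand)
    then show ?thesis using dpos[of i] by (metis Ints_of_int less_irrefl nonzero_mult_div_cancel_left of_int_eq_0_iff times_divide_eq_right)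
  qed
  \<comment> \<open>Powers of \<open>\<omega>\<close> repeat with period \<open>m\<close>, so the
    denominators at exponents below \<open>m\<close> suffice for all exponents.\<close>
  define N where "N = (\<Prod>i<m. d i)"
  have Npos: "N > 0" unfolding N_def by (intro prod_pos) (simp add: dpos)
  have Nint: "of_int N * \<phi> (\<omega> ^ i) \<in> \<int>" for i
  proof -
    have "\<omega> ^ i = \<omega> ^ (i mod m)"
      by (metis assms(2) div_mult_mod_eq mult.commute mult_1 power_add power_mult power_one)
    moreover have "d (i mod m) dvd N"
      unfolding N_def using assms(1) by (intro dvd_prodI) auto
    then obtain c where "N = c * d (i mod m)" by (metis dvd_def mult.commute)
    ultimately show ?thesis using dint[of "i mod m"] by (simp add: mult.assoc)
  qed
  have "p \<le> nat N" if "y = of_nat p * poly (map_poly of_int g) \<omega>" for p and g :: "int poly"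
  proof -
    let ?w = "poly (map_poly of_int g) \<omega>"
    have scale_int: "\<phi> (of_int c * u) = of_int c * \<phi> u" for c u
      using scale[of "of_int c" u] by simp
    have "?w = (\<Sum>i\<le>degree g. of_int (coeff g i) * \<omega> ^ i)"
      by (simp add: poly_altdef degree_map_poly coeff_map_poly)
    then have "\<phi> ?w = (\<Sum>i\<le>degree g. of_int (coeff g i) * \<phi> (\<omega> ^ i))"
      using sum_comp_morphism[of \<phi> "\<lambda>i. of_int (coeff g i) * \<omega> ^ i" "{..degree g}"]
        z add scale_int by (simp add: o_def)
    then have "of_int N * \<phi> ?w = (\<Sum>i\<le>degree g. of_int (coeff g i) * (of_int N * \<phi> (\<omega> ^ i)))"
      by (simp add: sum_distrib_left mult_ac)
    also have "\<dots> \<in> \<int>" by (intro Ints_sum Ints_mult Nint) auto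
    finally obtain t where t: "of_int N * \<phi> ?w = of_int t" by (auto elim: Ints_cases)
    \<comment> \<open>Applying \<open>\<phi>\<close> to \<open>y = p * w\<close> and multiplying by
      \<open>N\<close>, which makes \<open>N * \<phi> w\<close> an integer, shows that
      \<open>p\<close> divides \<open>N\<close>.\<close>
    have "1 = of_nat p * \<phi> ?w" using y scale[of "of_nat p" ?w] that by simp
    then have "of_int N = of_nat p * (of_int N * \<phi> ?w)" by (metis mult.left_commute mult.right_neutral)
    then have "of_int N = (of_int (int p * t) :: rat)" unfolding t by simp
    then have "N = int p * t" by (simp only: of_int_eq_iff)
    then have "int p \<le> N" using Npos by (metis dvd_triv_left zdvd_imp_le)
    then show ?thesis by simp
  qed
  then show ?thesis by blast
qed

section \<open>Conjugacy of powers of a root of unity and of cosines\<close>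

lemma int_poly_root_of_unity_conjugate:
  fixes \<omega> :: complex and f :: "int poly"
  assumes m: "m > 0" "\<omega> ^ m = 1" and root: "poly (map_poly of_int f) \<omega> = 0" and cop: "coprime j m"
  shows "poly (map_poly of_int f) (\<omega> ^ j) = 0"
proof -
  let ?e = "\<lambda>(f::int poly) (z::complex). poly (map_poly of_int f) z"
  \<comment> \<open>Exponents below \<open>m\<close> already give all values at powers of
    \<open>\<omega>\<close>, so the set of nonzero values is finite.\<close>
  let ?Y = "(\<lambda>k. ?e f (\<omega> ^ k)) ` {..<m} - {0}"
  have per: "\<omega> ^ i = \<omega> ^ (i mod m)" for i
    by (metis m(2) div_mult_mod_eq mult.commute mult_1 power_add power_mult power_one)
  have "\<forall>y\<in>?Y. \<exists>N. \<forall>p g. y = of_nat p * ?e g \<omega> \<longrightarrow> p \<le> N"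
    using int_poly_eval_divisor_bound[OF m] by blast
  then obtain N where N: "\<And>y p g. y \<in> ?Y \<Longrightarrow> y = of_nat p * ?e g \<omega> \<Longrightarrow> p \<le> N y"
    by metis
  define B where "B = (\<Sum>y\<in>?Y. N y)"
  have B: "N y \<le> B" if "y \<in> ?Y" for y
    unfolding B_def using that by (intro member_le_sum) auto
  have step: "?e f (\<omega> ^ (k * p)) = 0" if k: "?e f (\<omega> ^ k) = 0" and p: "prime p" "p > B" for k p
  proof (rule ccontr)
    assume nz: "?e f (\<omega> ^ (k * p)) \<noteq> 0"
    obtain g where g: "\<And>z. ?e f (z ^ p) = ?e f z ^ p + of_nat p * ?e g z"
      using frobenius_eval[OF p(1)] by metis
    have "?e f (\<omega> ^ (k * p)) = of_nat p * ?e g (\<omega> ^ k)"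
      using g[of "\<omega> ^ k"] k prime_gt_0_nat[OF p(1)] by (simp add: power_mult power_0_left)
    \<comment> \<open>The divisor bound concerns values at \<open>\<omega>\<close> itself, so the
      exponent \<open>k\<close> is moved into the polynomial.\<close>
    also have "?e g (\<omega> ^ k) = ?e (pcompose g (monom 1 k)) \<omega>"
      by (induction g)
        (simp_all add: pcompose_pCons map_poly_pCons map_poly_add_hom map_poly_mult_hom
          map_poly_monom poly_monom)
    finally have "p \<le> N (?e f (\<omega> ^ (k * p)))"
    proof (rule N[rotated])
      show "?e f (\<omega> ^ (k * p)) \<in> ?Y"
        using nz per[of "k * p"] m(1) by auto
    qed
    moreover have "?e f (\<omega> ^ (k * p)) \<in> ?Y"
      using nz per[of "k * p"] m(1) by auto
    ultimately show False using B p(2) by fastforce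
  qed
  \<comment> \<open>Starting from the root \<open>\<omega>\<close>, the prime factors of
    \<open>k\<close> are put into the exponent one at a time.\<close>
  have large: "?e f (\<omega> ^ k) = 0" if "k > 0" "\<And>p. prime p \<Longrightarrow> p dvd k \<Longrightarrow> p > B" for k
    using that
  proof (induction k rule: prime_divisors_induct)
    case (factor p k)
    then show ?case using step[of k p] by (auto simp: mult.commute)
  qed (use root in auto)
  \<comment> \<open>Replace \<open>j\<close> by a number \<open>k\<close> congruent to it modulo \<open>m\<close> all of whose prime factors exceed \<open>B\<close>,
    so that \<open>large\<close> applies.\<close>
  define P where "P = {q. prime q \<and> q \<le> B \<and> \<not> q dvd j}"
  define k where "k = j + m * \<Prod>P"
  have finP: "finite P" by (rule finite_subset[of _ "{..B}"]) (auto simp: P_def)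
  \<comment> \<open>A prime up to \<open>B\<close> divides exactly one of the summands
    \<open>j\<close> and \<open>m * \<Prod>P\<close>, hence not their sum.\<close>
  have "p > B" if "prime p" "p dvd k" for p
  proof (rule ccontr)
    assume "\<not> p > B"
    show False
    proof (cases "p dvd j")
      case True
      then have "p dvd m * \<Prod>P" using that(2) by (simp add: k_def dvd_add_right_iff)
      moreover have "\<not> p dvd m" using cop True that(1) by (meson coprime_common_divisor not_prime_unit)
      ultimately have "p dvd \<Prod>P" using that(1) by (simp add: prime_dvd_mult_iff)
      then obtain q where "q \<in> P" "p dvd q" using prime_dvd_prod_iff[OF finP \<open>prime p\<close>] by auto
      then show False using True that(1) primes_dvd_imp_eq[of p q] by (auto simp: P_def)
    next
      case False
      then have "p \<in> P" using that(1) \<open>\<not> p > B\<close> by (auto simp: P_def)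
      then have "p dvd \<Prod>P" using finP by (metis dvd_prod_eqI)
      then show False using False that(2) by (simp add: k_def dvd_add_left_iff)
    qed
  qed
  moreover have "k > 0"
    using m(1) finP by (auto simp: k_def P_def intro!: prod_pos prime_gt_0_nat)
  ultimately have "?e f (\<omega> ^ k) = 0" by (intro large) auto
  moreover have "\<omega> ^ k = \<omega> ^ j" by (simp add: k_def power_add power_mult m(2))
  ultimately show ?thesis by simp
qed

text \<open>Multiplying by the product of all coefficient denominators reduces this to integer
  polynomials.\<close>

lemma rat_poly_root_of_unity_conjugate:
  fixes \<omega> :: complex and f :: "rat poly"
  assumes "m > 0" "\<omega> ^ m = 1" "poly (map_poly of_rat f) \<omega> = 0" "coprime j m"
  shows "poly (map_poly of_rat f) (\<omega> ^ j) = 0"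
proof -
  define c where "c = (\<Prod>i\<le>degree f. snd (quotient_of (coeff f i)))"
  have c: "c > 0" unfolding c_def by (intro prod_pos) (simp add: quotient_of_denom_pos')
  have "coeff (smult (of_int c) f) i \<in> \<int>" for i
  proof (cases "i \<le> degree f")
    case True
    then have "snd (quotient_of (coeff f i)) dvd c" unfolding c_def by (intro dvd_prodI) auto
    then obtain b where b: "c = b * snd (quotient_of (coeff f i))" by (metis dvd_def mult.commute)
    have "snd (quotient_of (coeff f i)) > 0" by (simp add: quotient_of_denom_pos')
    moreover have "coeff f i = of_int (fst (quotient_of (coeff f i))) / of_int (snd (quotient_of (coeff f i)))"
      by (simp add: quotient_of_div prod.expand)
    ultimately have "of_int c * coeff f i = of_int (b * fst (quotient_of (coeff f i)))"
      by (simp add: b field_simps)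
    then show ?thesis by (metis Ints_of_int coeff_smult)
  qed (simp add: coeff_eq_0)
  then obtain g where g: "smult (of_int c) f = map_poly of_int g" by (rule intpolyE)
  have "poly (map_poly of_int g) z = of_int c * poly (map_poly of_rat f) z" for z :: complex
  proof -
    have "map_poly of_int g = map_poly of_rat (map_poly of_int g :: rat poly)"
      by (intro poly_eqI) (simp add: coeff_map_poly)
    also have "\<dots> = smult (of_int c) (map_poly of_rat f :: complex poly)"
      unfolding g[symmetric] by (intro poly_eqI) (simp add: coeff_map_poly of_rat_mult)
    finally show ?thesis by simp
  qed
  then show ?thesis using int_poly_root_of_unity_conjugate[OF assms(1,2) _ assms(4), of g] assms(3) c by simp
qed

text \<open>The cosine values are sums of a power of \<open>cis (pi / n)\<close> and its complex
  conjugate, so conjugacy of these powers carries over.\<close>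

lemma rat_eval_cos_conjugate:
  fixes r :: "rat poly"
  assumes n: "n > 0" and r: "rat_eval r (2 * cos (pi / real n)) = 0" and cop: "coprime j (2 * n)"
  shows "rat_eval r (2 * cos (real j * pi / real n)) = 0"
proof -
  define \<omega> where "\<omega> = cis (pi / real n)"
  \<comment> \<open>On powers of \<open>\<omega>\<close> the exponent \<open>2 * n - 1\<close> acts
    as -1, that is, as complex conjugation, while \<open>f\<close> remains a polynomial.\<close>
  define f where "f = pcompose r (monom 1 1 + monom 1 (2 * n - 1))"
  have "\<omega> ^ (2 * n) = cis (2 * pi)" unfolding \<omega>_def Complex.DeMoivre using n by simp
  then have \<omega>: "\<omega> ^ (2 * n) = 1" by simp
  have cplx: "poly (map_poly of_rat r) (complex_of_real x) = of_real (rat_eval r x)" for x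
  proof (induction r)
    case (pCons c r)
    have "complex_of_rat c = of_real (of_rat c)"
      by (cases c) (simp add: of_rat_rat)
    with pCons show ?case by (simp add: map_poly_pCons)
  qed simp
  have f: "poly (map_poly of_rat f) (\<omega> ^ i) = of_real (rat_eval r (2 * cos (real i * pi / real n)))" for i
  proof -
    have "poly (map_poly of_rat f) z = poly (map_poly of_rat r) (z + z ^ (2 * n - 1))" for z :: complex
      unfolding f_def
      by (induction r)
        (simp_all add: pcompose_pCons map_poly_pCons map_poly_add_hom map_poly_mult_hom
          map_poly_monom poly_monom of_rat_add of_rat_mult)
    moreover have "(\<omega> ^ i) ^ (2 * n - 1) = cnj (\<omega> ^ i)"
    proof -
      have "\<omega> ^ i * (\<omega> ^ i) ^ (2 * n - 1) = (\<omega> ^ (2 * n)) ^ i"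
        using n power_minus_mult[of "2 * n" "\<omega> ^ i"] by (metis mult.commute nat_0_less_mult_iff power_mult zero_less_numeral)
      also have "\<dots> = \<omega> ^ i * cnj (\<omega> ^ i)"
        unfolding \<omega> complex_norm_square[symmetric] by (simp add: \<omega>_def norm_power)
      finally show ?thesis by (simp add: \<omega>_def)
    qed
    moreover have "\<omega> ^ i + cnj (\<omega> ^ i) = of_real (2 * cos (real i * pi / real n))"
      unfolding complex_add_cnj \<omega>_def Complex.DeMoivre by simp
    ultimately show ?thesis using cplx by metis
  qed
  have "poly (map_poly of_rat f) (\<omega> ^ j) = 0"
    using rat_poly_root_of_unity_conjugate[of "2 * n" \<omega> f j] n \<omega> f[of 1] r cop by simp
  then show ?thesis using f[of j] by simp
qed

section \<open>Monic polynomials with given roots, and rationality of quotients\<close>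

text \<open>Both sides have the same leading coefficient and agree at \<open>card I\<close> points.
  For infinite \<open>I\<close>, \<open>card I\<close> is 0 and both sides are 1.\<close>

lemma monic_eq_prod_linear_factors:
  fixes p :: "real poly"
  assumes "lead_coeff p = 1" "degree p = card I" "inj_on f I" "\<And>i. i \<in> I \<Longrightarrow> poly p (f i) = 0"
  shows "p = (\<Prod>i\<in>I. [:- f i, 1:])"
proof (cases "finite I")
  case True
  let ?q = "\<Prod>i\<in>I. [:- f i, 1:]"
  have deg: "degree ?q = card I" by (subst degree_prod_sum_eq) auto
  show ?thesis
  proof (rule poly_eqI_degree_lead_coeff[of _ "card I" _ "f ` I"])
    show "coeff p (card I) = coeff ?q (card I)"
      using assms(1,2) deg lead_coeff_prod[of "\<lambda>i. [:- f i, 1:]" I] by simp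
    show "poly p z = poly ?q z" if "z \<in> f ` I" for z
      using that assms(4) True by (auto simp: poly_prod)
  qed (use assms(2,3) deg in \<open>auto simp: card_image\<close>)
next
  case False
  then show ?thesis using assms(1,2) by (auto elim: degree_eq_zeroE)
qed

lemma map_poly_of_rat_mult:
  "map_poly (of_rat :: rat \<Rightarrow> real) (p * q) = map_poly of_rat p * map_poly of_rat q"
  by (simp add: map_poly_mult_hom of_rat_add of_rat_mult)

lemma map_poly_of_rat_prod:
  "map_poly (of_rat :: rat \<Rightarrow> real) (\<Prod>i\<in>I. f i) = (\<Prod>i\<in>I. map_poly of_rat (f i))"
  by (induction I rule: infinite_finite_induct) (simp_all add: map_poly_of_rat_mult)

text \<open>Division with remainder over the rationals remains one over the reals: a nonzero
  remainder would be a real multiple of \<open>q\<close> of smaller degree than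
  \<open>q\<close>.\<close>

lemma real_quotient_of_rat_polys:
  fixes p q :: "rat poly" and F :: "real poly"
  assumes "map_poly of_rat p = F * map_poly of_rat q" "q \<noteq> 0"
  obtains G where "p = G * q" "map_poly of_rat G = F"
proof -
  let ?r = "\<lambda>p. map_poly of_rat p :: real poly"
  have "?r (p div q * q + p mod q) = ?r (p div q) * ?r q + ?r (p mod q)"
    by (simp only: map_poly_add_hom[of of_rat, OF of_rat_0 of_rat_add] map_poly_of_rat_mult)
  then have "?r p = ?r (p div q) * ?r q + ?r (p mod q)" by simp
  then have eq: "?r (p mod q) = (F - ?r (p div q)) * ?r q"
    using assms(1) by (simp add: algebra_simps)
  have q: "?r q \<noteq> 0" using assms(2) by (simp add: map_poly_eq_0_iff)
  have F: "F - ?r (p div q) = 0"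
  proof (rule ccontr)
    assume nz: "F - ?r (p div q) \<noteq> 0"
    then have "p mod q \<noteq> 0" using eq q by auto
    then have "degree (p mod q) < degree q" using assms(2) degree_mod_less' by blast
    moreover have "degree (?r (p mod q)) \<ge> degree (?r q)"
      unfolding eq using nz q by (simp add: degree_mult_eq)
    ultimately show False by (simp add: degree_map_poly)
  qed
  then have "p mod q = 0" using eq by (simp add: map_poly_eq_0_iff)
  then have "p = (p div q) * q" by (simp add: minus_mod_eq_div_mult[symmetric])
  then show thesis using that F by simp
qed

section \<open>Factorization of \<open>S_poly\<close>, \<open>q_denom\<close> and
  \<open>q_fun\<close> over the reals\<close>

text \<open>Only the fraction \<open>j / m\<close> matters, so the polynomials belonging to
  different divisors of \<open>n\<close> share one grid of roots.\<close>

definition cos_factor :: "nat \<Rightarrow> nat \<Rightarrow> real poly" where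
  "cos_factor m j = [:- (2 * cos (real j * pi / real m)), 1:]"

lemma grid_angle_le_pi:
  assumes "i \<le> m"
  shows "real i * pi / real m \<le> pi"
proof -
  have "real i / real m \<le> 1" using assms by (auto simp: divide_le_eq_1)
  then have "real i / real m * pi \<le> 1 * pi" by (rule mult_right_mono) simp
  then show ?thesis by simp
qed

lemma inj_on_cos_grid: "inj_on (\<lambda>j. 2 * cos (real j * pi / real m)) {..m}"
proof (cases "m = 0")
  case False
  have "i = j" if ij: "i \<le> m" "j \<le> m"
    and eq: "cos (real i * pi / real m) = cos (real j * pi / real m)" for i j
  proof -
    have "real i * pi / real m = real j * pi / real m"
      by (rule cos_inj_pi[OF _ grid_angle_le_pi[OF ij(1)] _ grid_angle_le_pi[OF ij(2)] eq]) simp_all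
    then show ?thesis using False by simp
  qed
  then show ?thesis by (intro inj_onI) (simp only: atMost_iff mult_cancel_left, simp)
qed simp

lemma rat_eval_S_poly_root:
  assumes "1 \<le> i" "i \<le> k"
  shows "rat_eval (S_poly k) (2 * cos (real i * pi / real (Suc k))) = 0"
proof -
  let ?t = "real i * pi / real (Suc k)"
  have "rat_eval (S_poly k) (2 * cos ?t) * sin ?t = sin (real i * pi)"
    unfolding rat_eval_S_poly_cos by simp
  moreover have "sin ?t > 0"
  proof (rule sin_gt_zero)
    show "?t > 0" using assms by simp
    have "real i / real (Suc k) < 1" using assms by simp
    then have "real i / real (Suc k) * pi < 1 * pi" by (rule mult_strict_right_mono) simp
    then show "?t < pi" by simp
  qed
  ultimately show ?thesis by simp
qed

lemma S_poly_monic: "degree (S_poly k) = k" "coeff (S_poly k) k = 1"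
  using degree_S_poly[of k] by auto

lemma S_poly_factorization:
  "map_poly of_rat (S_poly k) = (\<Prod>j\<in>{1..k}. cos_factor (Suc k) j)"
  unfolding cos_factor_def
proof (rule monic_eq_prod_linear_factors)
  show "inj_on (\<lambda>j. 2 * cos (real j * pi / real (Suc k))) {1..k}"
    by (rule inj_on_subset[OF inj_on_cos_grid]) auto
  show "poly (map_poly of_rat (S_poly k)) (2 * cos (real i * pi / real (Suc k))) = 0"
    if "i \<in> {1..k}" for i
    using that rat_eval_S_poly_root[of i k] by (simp add: rat_eval_def)
qed (simp_all add: S_poly_monic degree_map_poly coeff_map_poly)

lemma q_denom_monic: "degree (q_denom k) = k" "lead_coeff (q_denom k) = 1"
proof -
  let ?h = "even_half (S_poly (2 * k))"
  have c: "coeff ?h i = coeff (S_poly (2 * k)) (2 * i)" for i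
    by (auto simp: even_half_def coeff_sum coeff_monom coeff_eq_0)
  have "degree ?h \<le> k" by (rule degree_le) (simp add: c coeff_eq_0 S_poly_monic)
  moreover have "k \<le> degree ?h" by (rule le_degree) (simp add: c S_poly_monic)
  ultimately have h: "degree ?h = k" by simp
  show "degree (q_denom k) = k" by (simp add: q_denom_def degree_pcompose h)
  show "lead_coeff (q_denom k) = 1"
    unfolding q_denom_def by (subst lead_coeff_comp) (simp_all add: h c S_poly_monic)
qed

text \<open>For \<open>x = 2 * cos (2 * t)\<close> the square root of \<open>2 + x\<close> is
  \<open>2 * cos t\<close>, so roots of \<open>S_poly (2 * k)\<close> yield roots at the doubled
  angles.\<close>

lemma q_denom_factorization:
  "map_poly of_rat (q_denom k) = (\<Prod>i\<in>{1..k}. cos_factor (Suc (2 * k)) (2 * i))"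
  unfolding cos_factor_def
proof (rule monic_eq_prod_linear_factors)
  let ?m = "Suc (2 * k)"
  show "inj_on (\<lambda>i. 2 * cos (real (2 * i) * pi / real ?m)) {1..k}"
  proof (rule inj_onI)
    fix i j assume "i \<in> {1..k}" "j \<in> {1..k}"
      "2 * cos (real (2 * i) * pi / real ?m) = 2 * cos (real (2 * j) * pi / real ?m)"
    then have "2 * i = 2 * j" by (intro inj_onD[OF inj_on_cos_grid[of ?m]]) auto
    then show "i = j" by simp
  qed
  show "poly (map_poly of_rat (q_denom k)) (2 * cos (real (2 * i) * pi / real ?m)) = 0"
    if i: "i \<in> {1..k}" for i
  proof -
    let ?t = "real i * pi / real ?m"
    have t: "real (2 * i) * pi / real ?m = 2 * ?t" by simp
    have "(2 * cos ?t)\<^sup>2 = 2 + 2 * cos (2 * ?t)"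
      by (simp only: cos_double_cos) (simp add: power_mult_distrib)
    \<comment> \<open>Here \<open>i \<le> k\<close> keeps the angle within \<open>pi / 2\<close>, so
      the square root is \<open>2 * cos t\<close> and not its negative.\<close>
    moreover have "0 \<le> cos ?t"
    proof (rule cos_ge_zero)
      have "real (2 * i) * pi / real ?m \<le> pi" using i by (intro grid_angle_le_pi) auto
      then show "?t \<le> pi / 2" unfolding t by linarith
      show "- (pi / 2) \<le> ?t" by (rule order_trans[of _ 0]) auto
    qed
    then have "0 \<le> 2 * cos ?t" by (rule mult_nonneg_nonneg[rotated]) simp
    ultimately have "sqrt (2 + 2 * cos (2 * ?t)) = 2 * cos ?t" by (intro real_sqrt_unique)
    moreover have "rat_eval (S_poly (2 * k)) (2 * cos ?t) = 0"
      using i by (intro rat_eval_S_poly_root) auto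
    moreover have "2 * cos (2 * ?t) \<ge> -2" using cos_ge_minus_one[of "2 * ?t"] by linarith
    ultimately have "rat_eval (q_denom k) (2 * cos (2 * ?t)) = 0"
      by (simp only: rat_eval_q_denom)
    then show ?thesis unfolding t rat_eval_def .
  qed
qed (use q_denom_monic[of k] in \<open>simp_all add: degree_map_poly coeff_map_poly\<close>)

text \<open>The denominator cancels exactly the roots of the numerator with even index.\<close>

lemma q_fun_factorization:
  obtains F where "q_fun k = to_fract F"
    "map_poly of_rat F = (\<Prod>j | j < Suc (2 * k) \<and> odd j. cos_factor (Suc (2 * k)) j)"
proof -
  let ?L = "cos_factor (Suc (2 * k))"
  let ?O = "{j. j < Suc (2 * k) \<and> odd j}"
  have split: "{1..2 * k} = ?O \<union> (\<lambda>i. 2 * i) ` {1..k}"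
    by (auto simp: Suc_le_eq odd_pos elim!: evenE)
  have "prod ?L {1..2 * k} = prod ?L ?O * prod ?L ((\<lambda>i. 2 * i) ` {1..k})"
    unfolding split by (rule prod.union_disjoint) auto
  also have "prod ?L ((\<lambda>i. 2 * i) ` {1..k}) = map_poly of_rat (q_denom k)"
    unfolding q_denom_factorization by (subst prod.reindex) (auto simp: inj_on_def)
  finally have "map_poly of_rat (S_poly (2 * k)) = prod ?L ?O * map_poly of_rat (q_denom k)"
    unfolding S_poly_factorization .
  then obtain F where F: "S_poly (2 * k) = F * q_denom k" "map_poly of_rat F = prod ?L ?O"
    by (rule real_quotient_of_rat_polys[OF _ q_denom_nonzero])
  have "q_fun k = to_fract F" unfolding q_fun_def F(1) by simp
  then show thesis using that F(2) by blast
qed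

text \<open>With \<open>n = d * m\<close>, the odd \<open>i < m\<close> correspond to the odd
  multiples \<open>d * i < n\<close>, as \<open>d\<close> is odd, and the angles agree.\<close>

lemma q_fun_divisor_factorization:
  assumes "odd n" "d dvd n"
  shows "\<exists>F. q_fun ((n div d - 1) div 2) = to_fract F \<and>
    map_poly of_rat F = (\<Prod>j | j < n \<and> odd j \<and> d dvd j. cos_factor n j)"
proof -
  obtain m where m: "n = d * m" using assms(2) by (rule dvdE)
  have od: "odd d" "odd m" using assms(1) unfolding m by simp_all
  have pos: "d > 0" "m > 0" using od by (simp_all add: odd_pos)
  define k where "k = m div 2"
  have k: "Suc (2 * k) = m" using odd_two_times_div_two_succ[OF od(2)] by (simp add: k_def)
  obtain F where F: "q_fun k = to_fract F"
    "map_poly of_rat F = (\<Prod>j | j < Suc (2 * k) \<and> odd j. cos_factor (Suc (2 * k)) j)"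
    by (rule q_fun_factorization)
  have "{j. j < n \<and> odd j \<and> d dvd j} = (\<lambda>j. d * j) ` {j. j < m \<and> odd j}"
  proof (intro set_eqI iffI)
    fix j assume "j \<in> {j. j < n \<and> odd j \<and> d dvd j}"
    moreover from this obtain i where "j = d * i" by blast
    ultimately show "j \<in> (\<lambda>j. d * j) ` {j. j < m \<and> odd j}" using pos by (auto simp: m)
  qed (use od pos in \<open>auto simp: m\<close>)
  then have "(\<Prod>j | j < n \<and> odd j \<and> d dvd j. cos_factor n j)
      = (\<Prod>j | j < m \<and> odd j. cos_factor n (d * j))"
    using pos by (simp add: prod.reindex inj_on_def)
  also have "\<dots> = (\<Prod>j | j < m \<and> odd j. cos_factor m j)"
    using pos by (intro prod.cong) (simp_all add: cos_factor_def m)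
  finally have "map_poly of_rat F = (\<Prod>j | j < n \<and> odd j \<and> d dvd j. cos_factor n j)"
    using F(2) k by simp
  moreover have "(n div d - 1) div 2 = k" unfolding m k[symmetric] using pos by simp
  ultimately show ?thesis using F(1) by blast
qed

section \<open>Inclusion and exclusion over subsets\<close>

text \<open>Toggling a fixed element of \<open>B\<close> exchanges even and odd subsets; the empty
  set has only one subset, an even one.\<close>

lemma card_even_subsets:
  assumes "finite B"
  shows "card {A. A \<subseteq> B \<and> even (card A)} = of_bool (B = {}) + card {A. A \<subseteq> B \<and> odd (card A)}"
proof (cases "B = {}")
  case True
  then have "{A. A \<subseteq> B \<and> even (card A)} = {{}}" "{A. A \<subseteq> B \<and> odd (card A)} = {}" by auto
  then show ?thesis using True by simp
next
  case False
  then obtain b where b: "b \<in> B" by blast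
  define t where "t = (\<lambda>A. if b \<in> A then A - {b} else insert b A)"
  have inv: "t (t A) = A" for A by (auto simp: t_def)
  have par: "even (card (t A)) \<longleftrightarrow> odd (card A)" if "A \<subseteq> B" for A
  proof -
    have "finite A" using that assms by (rule finite_subset)
    then show ?thesis
      by (cases "b \<in> A") (auto simp: t_def card_Diff_singleton card_gt_0_iff)
  qed
  have sub: "t A \<subseteq> B" if "A \<subseteq> B" for A using that b by (auto simp: t_def)
  have "bij_betw t {A. A \<subseteq> B \<and> even (card A)} {A. A \<subseteq> B \<and> odd (card A)}"
    by (rule bij_betw_byWitness[where f' = t]) (auto simp: inv par sub dest: subsetD[OF sub])
  then show ?thesis using False by (simp add: bij_betw_same_card)
qed

text \<open>After exchanging the products, the exponent of \<open>h j\<close> counts the even or odd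
  subsets of \<open>B j\<close>. The form without division makes sense in any commutative
  monoid.\<close>

lemma prod_even_subsets_eq:
  fixes h :: "'j \<Rightarrow> 'b::comm_monoid_mult"
  assumes fin: "finite I" "finite J" and B: "\<And>j. j \<in> J \<Longrightarrow> B j \<subseteq> I"
  shows "(\<Prod>A | A \<subseteq> I \<and> even (card A). \<Prod>j | j \<in> J \<and> A \<subseteq> B j. h j) =
    (\<Prod>j | j \<in> J \<and> B j = {}. h j) *
    (\<Prod>A | A \<subseteq> I \<and> odd (card A). \<Prod>j | j \<in> J \<and> A \<subseteq> B j. h j)"
proof -
  have swap: "(\<Prod>A | A \<subseteq> I \<and> P A. \<Prod>j | j \<in> J \<and> A \<subseteq> B j. h j) =
      (\<Prod>j\<in>J. h j ^ card {A. A \<subseteq> B j \<and> P A})" for P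
  proof -
    have finA: "finite {A. A \<subseteq> I \<and> P A}" using fin(1) by simp
    have "(\<Prod>A | A \<subseteq> I \<and> P A. \<Prod>j | j \<in> J \<and> A \<subseteq> B j. h j) =
        (\<Prod>A | A \<subseteq> I \<and> P A. \<Prod>j\<in>J. if A \<subseteq> B j then h j else 1)"
      by (rule prod.cong[OF refl prod.inter_filter[OF fin(2)]])
    also have "\<dots> = (\<Prod>j\<in>J. \<Prod>A | A \<subseteq> I \<and> P A. if A \<subseteq> B j then h j else 1)"
      by (rule prod.swap)
    also have "\<dots> = (\<Prod>j\<in>J. \<Prod>A\<in>{A. A \<subseteq> B j \<and> P A}. h j)"
    proof (rule prod.cong[OF refl])
      fix j assume "j \<in> J"
      then have "{A \<in> {A. A \<subseteq> I \<and> P A}. A \<subseteq> B j} = {A. A \<subseteq> B j \<and> P A}" using B by blast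
      then show "(\<Prod>A | A \<subseteq> I \<and> P A. if A \<subseteq> B j then h j else 1) =
          (\<Prod>A\<in>{A. A \<subseteq> B j \<and> P A}. h j)"
        using prod.inter_filter[OF finA, of "\<lambda>_. h j" "\<lambda>A. A \<subseteq> B j"] by simp
    qed
    finally show ?thesis by simp
  qed
  have "(\<Prod>j\<in>J. h j ^ card {A. A \<subseteq> B j \<and> even (card A)}) =
      (\<Prod>j\<in>J. (if B j = {} then h j else 1) * h j ^ card {A. A \<subseteq> B j \<and> odd (card A)})"
  proof (rule prod.cong[OF refl])
    fix j assume "j \<in> J"
    then have "finite (B j)" using B fin(1) finite_subset by blast
    then show "h j ^ card {A. A \<subseteq> B j \<and> even (card A)} =
        (if B j = {} then h j else 1) * h j ^ card {A. A \<subseteq> B j \<and> odd (card A)}"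
      by (simp only: card_even_subsets power_add) simp
  qed
  then show ?thesis
    unfolding swap prod.inter_filter[OF fin(2), of h "\<lambda>j. B j = {}"] by (simp only: prod.distrib)
qed

lemma prod_distinct_primes_dvd_iff:
  fixes p :: "'i \<Rightarrow> nat"
  assumes "finite A" "inj_on p A" "\<And>i. i \<in> A \<Longrightarrow> prime (p i)"
  shows "(\<Prod>i\<in>A. p i) dvd m \<longleftrightarrow> (\<forall>i\<in>A. p i dvd m)"
  using assms
proof (induction A rule: finite_induct)
  case (insert x A)
  have "coprime (p x) (\<Prod>i\<in>A. p i)"
    using insert.prems insert.hyps by (intro prod_coprime_right primes_coprime) auto
  then have "p x * prod p A dvd m \<longleftrightarrow> p x dvd m \<and> prod p A dvd m"
    by (auto intro: divides_mult elim: dvd_mult_left dvd_mult_right)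
  moreover have "prod p A dvd m \<longleftrightarrow> (\<forall>i\<in>A. p i dvd m)"
    using insert.prems by (intro insert.IH) auto
  ultimately show ?case using insert.hyps by simp
qed auto

section \<open>The minimal polynomial as an alternating product\<close>

theorem mainTheorem9:
  fixes n N :: nat and p e :: "nat \<Rightarrow> nat"
  assumes "n \<ge> 3" and "odd n"
    and "n = (\<Prod>j\<in>{1..N}. p j ^ e j)"
    and "inj_on p {1..N}"
    and "\<And>j. j \<in> {1..N} \<Longrightarrow> prime (p j) \<and> odd (p j) \<and> e j \<ge> 1"
  shows "to_fract (C_poly n) =
      (\<Prod>A | A \<subseteq> {1..N} \<and> even (card A). q_fun ((n div (\<Prod>j\<in>A. p j) - 1) div 2)) /
      (\<Prod>A | A \<subseteq> {1..N} \<and> odd (card A). q_fun ((n div (\<Prod>j\<in>A. p j) - 1) div 2))"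
proof -
  let ?I = "{1..N}" and ?a = "2 * cos (pi / real n)"
  let ?q = "\<lambda>A. q_fun ((n div (\<Prod>j\<in>A. p j) - 1) div 2)"
  define J where "J = {j. j < n \<and> odd j}"
  \<comment> \<open>These are the indices of the primes dividing \<open>j\<close>:
    \<open>A \<subseteq> B j\<close> says that the product over \<open>A\<close> divides
    \<open>j\<close>, and \<open>B j = {}\<close> that \<open>j\<close> is coprime to
    \<open>n\<close>.\<close>
  define B where "B = (\<lambda>j. {i\<in>?I. p i dvd j})"
  define D where "D = (\<Prod>j | j \<in> J \<and> B j = {}. cos_factor n j)"
  have finJ: "finite J" by (simp add: J_def)
  have "\<exists>F. ?q A = to_fract F \<and> map_poly of_rat F = (\<Prod>j | j \<in> J \<and> A \<subseteq> B j. cos_factor n j)"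
    if A: "A \<subseteq> ?I" for A
  proof -
    have fin: "finite A" using that by (rule finite_subset) simp
    have "prod p A dvd (\<Prod>j\<in>A. p j ^ e j)"
      using that assms(5) by (intro prod_dvd_prod) (auto intro!: dvd_power simp: Suc_le_eq)
    also have "\<dots> dvd n" unfolding assms(3) using that by (intro prod_dvd_prod_subset) auto
    finally have "prod p A dvd n" .
    moreover have "prod p A dvd j \<longleftrightarrow> A \<subseteq> B j" for j
    proof -
      have "prod p A dvd j \<longleftrightarrow> (\<forall>i\<in>A. p i dvd j)"
        using A assms(5) by (intro prod_distinct_primes_dvd_iff[OF fin inj_on_subset[OF assms(4) A]]) blast
      then show ?thesis using A by (auto simp: B_def)
    qed
    ultimately show ?thesis
      using q_fun_divisor_factorization[OF assms(2), of "prod p A"] by (simp add: J_def conj_assoc)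
  qed
  then obtain F where F: "\<And>A. A \<subseteq> ?I \<Longrightarrow> ?q A = to_fract (F A)"
    "\<And>A. A \<subseteq> ?I \<Longrightarrow> map_poly of_rat (F A) = (\<Prod>j | j \<in> J \<and> A \<subseteq> B j. cos_factor n j)"
    by metis
  have to_fract_prod: "to_fract (\<Prod>A\<in>\<A>. F A) = (\<Prod>A\<in>\<A>. to_fract (F A))" for \<A>
    by (induction \<A> rule: infinite_finite_induct) auto
  define P where "P = (\<lambda>Q. \<Prod>A | A \<subseteq> ?I \<and> Q (card A). F A)"
  have Pq: "to_fract (P Q) = (\<Prod>A | A \<subseteq> ?I \<and> Q (card A). ?q A)" for Q
    unfolding P_def to_fract_prod using F(1) by (intro prod.cong) auto
  have PL: "map_poly of_rat (P Q) =
      (\<Prod>A | A \<subseteq> ?I \<and> Q (card A). \<Prod>j | j \<in> J \<and> A \<subseteq> B j. cos_factor n j)" for Q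
    unfolding P_def map_poly_of_rat_prod using F(2) by (intro prod.cong) auto
  have "map_poly of_rat (P even) = D * map_poly of_rat (P odd)"
    unfolding PL D_def by (rule prod_even_subsets_eq) (auto simp: finJ B_def)
  moreover have nz: "P odd \<noteq> 0"
  proof -
    have "map_poly of_rat (P odd) \<noteq> (0 :: real poly)"
      unfolding PL by (auto simp: finJ cos_factor_def)
    then show ?thesis by auto
  qed
  \<comment> \<open>The candidate \<open>D\<close> was built over the reals; as a quotient of
    rational polynomials it descends to the rational polynomial \<open>G\<close>.\<close>
  ultimately obtain G where G: "P even = G * P odd" "map_poly of_rat G = D"
    by (rule real_quotient_of_rat_polys)

  have degD: "degree D = card {j. j \<in> J \<and> B j = {}}"
    unfolding D_def by (subst degree_prod_sum_eq) (auto simp: cos_factor_def)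
  have "lead_coeff D = 1"
    unfolding D_def lead_coeff_prod by (simp add: cos_factor_def)
  then have leadG: "lead_coeff G = 1"
    unfolding G(2)[symmetric] by (simp add: degree_map_poly coeff_map_poly)
  have "\<not> p i dvd 1" if "i \<in> ?I" for i
    using assms(5)[OF that] not_prime_unit by blast
  \<comment> \<open>The index 1 contributes the root \<open>?a\<close> itself.\<close>
  then have "1 \<in> {j. j \<in> J \<and> B j = {}}"
    using assms(1) by (auto simp: J_def B_def)
  moreover have "poly (cos_factor n 1) ?a = 0" by (simp add: cos_factor_def)
  ultimately have rootG: "rat_eval G ?a = 0"
    unfolding rat_eval_def G(2) D_def poly_prod using finJ by (intro prod_zero) auto
  \<comment> \<open>All roots of \<open>D\<close> are conjugates of \<open>?a\<close>, hence roots
    of \<open>r\<close>; being distinct, they force the degree of \<open>r\<close> up.\<close>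
  have min: "degree G \<le> degree r" if r: "r \<noteq> 0" "rat_eval r ?a = 0" for r
  proof -
    let ?c = "\<lambda>j. 2 * cos (real j * pi / real n)"
    have root: "rat_eval r (?c j) = 0" if j: "j \<in> J" "B j = {}" for j
    proof (rule rat_eval_cos_conjugate[OF _ r(2)])
      have "coprime j (p i ^ e i)" if "i \<in> ?I" for i
        using that j(2) assms(5)[OF that] prime_imp_coprime[of "p i" j]
        by (auto simp: B_def coprime_commute)
      then have "coprime j n" unfolding assms(3) by (intro prod_coprime_right)
      \<comment> \<open>The underlying root of unity has exponent \<open>2 * n\<close>, so
        coprimality to 2 is required as well.\<close>
      moreover have "odd j" using j(1) by (simp add: J_def)
      ultimately show "coprime j (2 * n)" by simp
    qed (use assms(1) in simp)
    have "degree G = card (?c ` {j. j \<in> J \<and> B j = {}})"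
    proof -
      have "inj_on ?c {j. j \<in> J \<and> B j = {}}"
        by (rule inj_on_subset[OF inj_on_cos_grid]) (auto simp: J_def)
      then show ?thesis
        using degD by (simp add: card_image G(2)[symmetric] degree_map_poly)
    qed
    also have "\<dots> \<le> card {x. poly (map_poly of_rat r :: real poly) x = 0}"
      using root r(1) by (intro card_mono poly_roots_finite)
        (auto simp: rat_eval_def map_poly_eq_0_iff)
    also have "\<dots> \<le> degree (map_poly of_rat r :: real poly)"
      using r(1) by (intro card_poly_roots_bound) (simp add: map_poly_eq_0_iff)
    finally show ?thesis by (simp add: degree_map_poly)
  qed
  have "is_rat_min_poly ?a G"
    unfolding is_rat_min_poly_def using leadG rootG min by blast
  then have "C_poly n = G"
    using C_poly_spec[of n] assms(1) by (intro is_rat_min_poly_unique) auto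
  then have "to_fract (C_poly n) = to_fract (P even) / to_fract (P odd)"
    using G(1) nz by simp
  then show ?thesis unfolding Pq .
qed

end
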